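(* Let $X\subset\mathbb P^4$ be a stable complex cubic threefold all of whose singular points are of type $A_3$. Then coplanarity is a transitive property on the set of singular points of $X$.
   Context: A cubic threefold in $\mathbb P^4$ is (GIT) stable if and only if it has only isolated singularities of type $A_1,A_2,A_3,A_4$ at worst. Two distinct singular points of a stable cubic threefold $X$ are called coplanar if both are contained in a (projective) plane that is contained in $X$. Transitivity is meant for distinct points: if $p,q,s$ are distinct singular points with $p,q$ coplanar and $q,s$ coplanar, then $p,s$ are coplanar. *)

theory Defs
  imports "HOL-Analysis.Analysis"
begin

text \<open>
  A \<open>d\<close>-dimensional linear subspace of the complex projective space \<open>P\<^sup>4\<close> is a
  \<open>(d + 1)\<close>-dimensional complex vector subspace of \<open>\<complex>\<^sup>5\<close>.  In particular a point of \<open>P\<^sup>4\<close>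
  is a line through the origin, and incidence is inclusion.  The constants
  \<open>vec.subspace\<close> and \<open>vec.dim\<close> refer to the complex vector space structure (scalar
  multiplication \<open>*s\<close>), unlike \<open>subspace\<close> and \<open>dim\<close>, which are real.
\<close>

definition proj_subspace :: "nat \<Rightarrow> (complex^5) set \<Rightarrow> bool" where
  "proj_subspace d S \<longleftrightarrow> vec.subspace S \<and> vec.dim S = d + 1"

abbreviation proj_point :: "(complex^5) set \<Rightarrow> bool" where
  "proj_point \<equiv> proj_subspace 0"

abbreviation proj_plane :: "(complex^5) set \<Rightarrow> bool" where
  "proj_plane \<equiv> proj_subspace 2"

text \<open>
  Forms are represented by the functions they induce, which loses nothing over \<open>\<complex>\<close>.
  The coefficients \<open>c\<close> need not be symmetric.
\<close>

definition cubic_form :: "(complex^5 \<Rightarrow> complex) \<Rightarrow> bool" where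
  "cubic_form F \<longleftrightarrow>
     F \<noteq> (\<lambda>x. 0) \<and>
     (\<exists>c. F = (\<lambda>x. \<Sum>i\<in>UNIV. \<Sum>j\<in>UNIV. \<Sum>k\<in>UNIV. c i j k * x $ i * x $ j * x $ k))"

definition hypersurface :: "(complex^5 \<Rightarrow> complex) \<Rightarrow> (complex^5) set set" where
  "hypersurface F = {p. proj_point p \<and> (\<forall>x\<in>p. F x = 0)}"

text \<open>
  For a polynomial \<open>F\<close>, the derivative at \<open>v\<close> is zero iff all partial derivatives vanish at \<open>v\<close>.
\<close>

definition singular_points :: "(complex^5 \<Rightarrow> complex) \<Rightarrow> (complex^5) set set" where
  "singular_points F =
     {p \<in> hypersurface F. \<forall>v\<in>p. v \<noteq> 0 \<longrightarrow> (F has_derivative (\<lambda>h. 0)) (at v)}"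

text \<open>
  Isolation in the quotient topology of \<open>P\<^sup>4\<close>, expressed with neighbourhoods in \<open>\<complex>\<^sup>5\<close> of the
  nonzero representatives.
\<close>

definition isolated_singular_point ::
  "(complex^5 \<Rightarrow> complex) \<Rightarrow> (complex^5) set \<Rightarrow> bool" where
  "isolated_singular_point F p \<longleftrightarrow>
     p \<in> singular_points F \<and>
     (\<forall>v\<in>p. v \<noteq> 0 \<longrightarrow>
        (\<exists>U. open U \<and> v \<in> U \<and> (\<forall>q\<in>singular_points F. q \<inter> U \<noteq> {} \<longrightarrow> q = p)))"

text \<open>
  Holomorphic functions of several variables on an open set: the real derivative exists and is
  complex linear; \<open>a\<close> is the vector of complex partial derivatives.
\<close>

definition holo_fun_on :: "(complex^'n \<Rightarrow> complex) \<Rightarrow> (complex^'n) set \<Rightarrow> bool" where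
  "holo_fun_on f U \<longleftrightarrow>
     open U \<and> (\<forall>x\<in>U. \<exists>a. (f has_derivative (\<lambda>h. \<Sum>i\<in>UNIV. a $ i * h $ i)) (at x))"

definition holo_map_on ::
  "(complex^'n \<Rightarrow> complex^'m) \<Rightarrow> (complex^'n) set \<Rightarrow> bool" where
  "holo_map_on \<phi> U \<longleftrightarrow> (\<forall>i. holo_fun_on (\<lambda>x. \<phi> x $ i) U)"

text \<open>
  The germ at the origin of the analytic hypersurface \<open>f = 0\<close> in \<open>\<complex>\<^sup>4\<close> is isomorphic to the
  standard three-dimensional \<open>A\<^sub>n\<close> germ: after a local biholomorphic change of coordinates \<open>\<phi>\<close>,
  the two equations agree up to a nowhere vanishing holomorphic factor \<open>u\<close>.
\<close>

definition A_germ :: "nat \<Rightarrow> (complex^4 \<Rightarrow> complex) \<Rightarrow> bool" where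
  "A_germ n f \<longleftrightarrow>
     (\<exists>U V (\<phi> :: complex^4 \<Rightarrow> complex^4) \<psi> u.
        0 \<in> U \<and> \<phi> 0 = 0 \<and> homeomorphism U V \<phi> \<psi> \<and>
        holo_map_on \<phi> U \<and> holo_map_on \<psi> V \<and>
        holo_fun_on u U \<and> (\<forall>y\<in>U. u y \<noteq> 0) \<and>
        (\<forall>y\<in>U. f (\<phi> y) = u y * ((y $ 1)^2 + (y $ 2)^2 + (y $ 3)^2 + (y $ 4)^(n + 1))))"

text \<open>
  The map \<open>y \<mapsto> [v + A y]\<close> is an affine chart of \<open>P\<^sup>4\<close> sending the origin to \<open>p = [v]\<close>: its image
  is the complement of the hyperplane \<open>range A\<close>.  The choice of \<open>v\<close> and \<open>A\<close> does not matter,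
  as two choices differ by a biholomorphic change of coordinates and, \<open>F\<close> being homogeneous,
  a nonvanishing factor.
\<close>

definition singularity_type_A ::
  "nat \<Rightarrow> (complex^5 \<Rightarrow> complex) \<Rightarrow> (complex^5) set \<Rightarrow> bool" where
  "singularity_type_A n F p \<longleftrightarrow>
     p \<in> singular_points F \<and>
     (\<exists>v\<in>p. \<exists>A :: complex^4^5.
        inj ((*v) A) \<and> v \<notin> range ((*v) A) \<and> A_germ n (\<lambda>y. F (v + A *v y)))"

text \<open>
  For cubic threefolds, GIT stability is equivalent to the following condition on the
  singularities (Allcock), which is taken here as the definition.
\<close>

definition stable_cubic_threefold :: "(complex^5 \<Rightarrow> complex) \<Rightarrow> bool" where
  "stable_cubic_threefold F \<longleftrightarrow>
     cubic_form F \<and>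
     (\<forall>p\<in>singular_points F.
        isolated_singular_point F p \<and> (\<exists>n\<in>{1..4}. singularity_type_A n F p))"

definition coplanar_points ::
  "(complex^5 \<Rightarrow> complex) \<Rightarrow> (complex^5) set \<Rightarrow> (complex^5) set \<Rightarrow> bool" where
  "coplanar_points F p q \<longleftrightarrow>
     p \<in> singular_points F \<and> q \<in> singular_points F \<and> p \<noteq> q \<and>
     (\<exists>S. proj_plane S \<and> p \<subseteq> S \<and> q \<subseteq> S \<and>
          {r. proj_point r \<and> r \<subseteq> S} \<subseteq> hypersurface F)"

end

theory Submission
  imports Defs
begin

text \<open>
  Let \<open>T\<close> be the symmetric trilinear form with \<open>F x = T x x x\<close>.  At a singular point \<open>[v]\<close> of type
  \<open>A\<^sub>n\<close> with \<open>n \<ge> 2\<close> the quadratic form \<open>w \<mapsto> T v w w\<close> on \<open>\<complex>\<^sup>5\<close> has rank exactly 3, with kernel spanned by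
  \<open>v\<close> and one further vector \<open>k\<close>.  A plane in \<open>X\<close> through \<open>[v]\<close> is a 3-dimensional isotropic subspace
  of this form, hence contains the whole kernel: all planes in \<open>X\<close> through \<open>[v]\<close> share the line
  \<open>L = [v, k]\<close>.

  Now let \<open>p = [x]\<close> and \<open>s = [z]\<close> lie with \<open>q = [v]\<close> in planes \<open>S1\<close> and \<open>S2\<close> of \<open>X\<close>.  If neither plane
  contains all three points, choose a point \<open>[m]\<close> of \<open>L\<close> with \<open>T x z m = 0\<close>.  Since \<open>T x x\<close> and \<open>T z z\<close>
  vanish by singularity, and \<open>T m m\<close> vanishes on \<open>S1\<close> and \<open>S2\<close>, the plane spanned by \<open>x, z, m\<close> lies in \<open>X\<close>.
\<close>

section \<open>Symmetric trilinear forms and polarization of cubics\<close>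

locale symmetric_trilinear =
  fixes T :: "complex^'n \<Rightarrow> complex^'n \<Rightarrow> complex^'n \<Rightarrow> complex"
  assumes swap_left: "T x y z = T y x z"
    and swap_right: "T x y z = T x z y"
    and add_left: "T (x + x') y z = T x y z + T x' y z"
    and scale_left: "T (a *s x) y z = a * T x y z"
begin

lemma add_middle: "T x (y + y') z = T x y z + T x y' z"
  by (metis add_left swap_left)

lemma add_right: "T x y (z + z') = T x y z + T x y z'"
  by (metis add_middle swap_right)

lemma scale_middle: "T x (a *s y) z = a * T x y z"
  by (metis scale_left swap_left)

lemma scale_right: "T x y (a *s z) = a * T x y z"
  by (metis scale_middle swap_right)

lemmas expand = add_left add_middle add_right scale_left scale_middle scale_right

text \<open>Taylor expansion of the cubic at \<open>v\<close>: the coefficient of \<open>t\<close>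
  detects singularity, and that of \<open>t^2\<close> is the Hessian form studied at singular
  points.\<close>

lemma cube_line:
  "T (v + t *s w) (v + t *s w) (v + t *s w)
    = T v v v + 3 * t * T v v w + 3 * t^2 * T v w w + t^3 * T w w w"
proof -
  have "T w v v = T v v w" "T v w v = T v v w" "T w v w = T v w w" "T w w v = T v w w"
    by (metis swap_left swap_right)+
  then show ?thesis
    by (simp add: expand algebra_simps power2_eq_square power3_eq_cube)
qed

text \<open>Inclusion-exclusion over the three arguments leaves only the mixed terms, six equal ones
  by symmetry. Hence a cubic vanishing on a subspace has a trilinear form vanishing there.\<close>

lemma polarize:
  "6 * T x y z = T (x + y + z) (x + y + z) (x + y + z)
    - T (x + y) (x + y) (x + y) - T (x + z) (x + z) (x + z) - T (y + z) (y + z) (y + z)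
    + T x x x + T y y y + T z z z"
proof -
  have "T x z y = T x y z" "T y x z = T x y z" "T y z x = T x y z" "T z x y = T x y z" "T z y x = T x y z"
    by (metis swap_left swap_right)+
  then show ?thesis
    by (simp add: expand algebra_simps)
qed

lemma vanish_on_subspace:
  assumes "vec.subspace S" and "\<And>x. x \<in> S \<Longrightarrow> T x x x = 0" and "x \<in> S" "y \<in> S" "z \<in> S"
  shows "T x y z = 0"
  using polarize[of x y z] assms by (simp add: vec.subspace_add)

end

lemma cubic_form_polarization:
  assumes "cubic_form F"
  obtains T where "symmetric_trilinear T" and "F = (\<lambda>x. T x x x)"
proof -
  obtain c where F: "F = (\<lambda>x. \<Sum>i\<in>UNIV. \<Sum>j\<in>UNIV. \<Sum>k\<in>UNIV. c i j k * x $ i * x $ j * x $ k)"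
    using assms unfolding cubic_form_def by blast
  define G where "G x y z = (\<Sum>i\<in>UNIV. \<Sum>j\<in>UNIV. \<Sum>k\<in>UNIV. c i j k * x $ i * y $ j * z $ k)"
    for x y z :: "complex^5"
  \<comment> \<open>The coefficients \<open>c\<close> need not be symmetric, so \<open>G\<close> is
    averaged over the six orders of its arguments; the diagonal is unchanged.\<close>
  define T where "T x y z = (G x y z + G x z y + G y x z + G y z x + G z x y + G z y x) / 6" for x y z
  have add: "G (x + x') y z = G x y z + G x' y z" "G x (y + y') z = G x y z + G x y' z"
    "G x y (z + z') = G x y z + G x y z'" for x x' y y' z z'
    by (simp_all add: G_def algebra_simps sum.distrib)
  have scale: "G (a *s x) y z = a * G x y z" "G x (a *s y) z = a * G x y z"
    "G x y (a *s z) = a * G x y z" for a x y z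
    by (simp_all add: G_def algebra_simps sum_distrib_left)
  have "symmetric_trilinear T"
    by unfold_locales (simp_all add: T_def add scale field_simps)
  moreover have "F = (\<lambda>x. T x x x)"
    by (simp add: F T_def G_def)
  ultimately show ?thesis by (rule that)
qed

lemma cubic_form_continuous:
  assumes "cubic_form F"
  shows "continuous_on UNIV F"
  using assms unfolding cubic_form_def by (auto intro!: continuous_intros)

section \<open>Isotropic vectors, planes in the cubic, and polars at singular points\<close>

text \<open>A smooth conic contains no line: a totally isotropic subspace of a nondegenerate ternary
  quadratic form has dimension at most one.\<close>

lemma isotropic_pair_dependent:
  fixes a b :: "complex^3"
  assumes "a$1^2 + a$2^2 + a$3^2 = 0" "b$1^2 + b$2^2 + b$3^2 = 0"
    and "a$1 * b$1 + a$2 * b$2 + a$3 * b$3 = 0"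
  obtains \<alpha> \<beta> where "\<alpha> \<noteq> 0 \<or> \<beta> \<noteq> 0" "\<alpha> *s a + \<beta> *s b = 0"
proof -
  have d: "a$2 * b$3 - a$3 * b$2 = 0" "a$3 * b$1 - a$1 * b$3 = 0" "a$1 * b$2 - a$2 * b$1 = 0"
  proof -
    \<comment> \<open>Lagrange's identity, applied to two coordinates at a time, shows that every
      component of the cross product of \<open>a\<close> and \<open>b\<close> squares to
      zero.\<close>
    have "(a$2 * b$3 - a$3 * b$2)^2 = 0" "(a$3 * b$1 - a$1 * b$3)^2 = 0" "(a$1 * b$2 - a$2 * b$1)^2 = 0"
      using assms by algebra+
    then show "a$2 * b$3 - a$3 * b$2 = 0" "a$3 * b$1 - a$1 * b$3 = 0" "a$1 * b$2 - a$2 * b$1 = 0"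
      by simp_all
  qed
  show ?thesis
  proof (cases "a = 0")
    case True
    then show ?thesis using that[of 1 0] by simp
  next
    case False
    then obtain i where i: "a $ i \<noteq> 0" by (auto simp: vec_eq_iff)
    have "b $ i * a $ j - a $ i * b $ j = 0" for j
      using d exhaust_3[of i] exhaust_3[of j] by (auto simp: algebra_simps)
    then have "b $ i *s a + (- a $ i) *s b = 0"
      by (simp add: vec_eq_iff)
    with i show ?thesis using that[of "b $ i" "- a $ i"] by simp
  qed
qed

lemma zero_on_plane:
  assumes "{r. proj_point r \<and> r \<subseteq> S} \<subseteq> hypersurface F" "vec.subspace S" "x \<in> S" "F 0 = 0"
  shows "F x = 0"
proof (cases "x = 0")
  case False
  have "proj_point (vec.span {x})"
    using False by (simp add: proj_subspace_def)
  moreover have "vec.span {x} \<subseteq> S"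
    using assms by (simp add: vec.span_minimal)
  ultimately show ?thesis
    using assms vec.span_base[of x "{x}"] by (auto simp: hypersurface_def)
qed (use assms in simp)

lemma bounded_linear_vector_scalar: "bounded_linear (\<lambda>t::complex. t *s (w::complex^'n))"
  by (intro linear_conv_bounded_linear[THEN iffD1] linearI)
    (simp_all add: vec_eq_iff algebra_simps)

lemma has_derivative_vector_scalar:
  "((\<lambda>t::complex. t *s (w::complex^'n)) has_derivative (\<lambda>t. t *s w)) F"
  by (rule bounded_linear_imp_has_derivative[OF bounded_linear_vector_scalar])

text \<open>The derivative of \<open>F\<close> at \<open>v\<close> in direction \<open>w\<close> is
  \<open>3 * T v v w\<close>, the linear coefficient in \<open>cube_line\<close>.\<close>

lemma singular_imp_polar_zero:
  assumes T: "symmetric_trilinear T" and F: "F = (\<lambda>x. T x x x)"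
    and p: "p \<in> singular_points F" and v: "v \<in> p"
  shows "T v v w = 0"
proof (cases "v = 0")
  case True
  then show ?thesis using symmetric_trilinear.scale_left[OF T, of 0 v] by simp
next
  case False
  then have "(F has_derivative (\<lambda>h. 0)) (at v)"
    using p v by (simp add: singular_points_def)
  then have d: "(F has_derivative (\<lambda>h. 0)) (at (v + 0 *s w))" by simp
  have e: "((\<lambda>t. v + t *s w) has_derivative (\<lambda>t. t *s w)) (at 0)"
    by (rule has_derivative_eq_rhs, rule has_derivative_add[OF has_derivative_const has_derivative_vector_scalar]) simp
  have "((\<lambda>t. F (v + t *s w)) has_derivative (\<lambda>t. 0)) (at 0)"
    using has_derivative_compose[OF e d] by simp
  then have "((\<lambda>t. F (v + t *s w)) has_field_derivative 0) (at 0)"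
    by (rule has_derivative_imp_has_field_derivative) simp
  moreover have "((\<lambda>t. F (v + t *s w)) has_field_derivative 3 * T v v w) (at 0)"
    unfolding F symmetric_trilinear.cube_line[OF T]
    by (auto intro!: derivative_eq_intros)
  ultimately show ?thesis
    using DERIV_unique by fastforce
qed


section \<open>The quadratic part of an A_n germ\<close>

lemma holo_map_on_has_derivative:
  fixes \<phi> :: "complex^'n \<Rightarrow> complex^'m"
  assumes "holo_map_on \<phi> U" and "x \<in> U"
  obtains D :: "complex^'n^'m" where "(\<phi> has_derivative (*v) D) (at x)"
proof -
  have "\<forall>i. \<exists>a. ((\<lambda>x. \<phi> x $ i) has_derivative (\<lambda>h. \<Sum>j\<in>UNIV. a $ j * h $ j)) (at x)"
    using assms by (auto simp: holo_map_on_def holo_fun_on_def)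
  then obtain a where a: "\<And>i. ((\<lambda>x. \<phi> x $ i) has_derivative (\<lambda>h. \<Sum>j\<in>UNIV. a i $ j * h $ j)) (at x)"
    by metis
  have "(\<phi> has_derivative (\<lambda>h. (\<chi> i. a i) *v h)) (at x)"
    unfolding has_derivative_componentwise_within[of \<phi>]
    using a by (auto simp: Basis_vec_def inner_axis matrix_vector_mult_def intro!: has_derivative_inner_left)
  then show ?thesis using that by blast
qed

text \<open>For \<open>n \<ge> 2\<close> the term \<open>(y $ 4)^(n + 1)\<close> has order at least
  three, so only three squares survive in degree two. The Jacobian \<open>D\<close> of the
  coordinate change carries the Hessian form to these squares, scaled by the value of the unit at
  the origin.\<close>

lemma A_germ_quadratic_part:
  fixes A :: "complex^4^5"
  assumes "symmetric_trilinear T" and F: "F = (\<lambda>x. T x x x)"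
    and contF: "continuous_on UNIV F" and v: "F v = 0" "\<And>w. T v v w = 0"
    and germ: "A_germ n (\<lambda>y. F (v + A *v y))" and n: "n \<ge> 2"
  obtains D :: "complex^4^4" and c where "inj ((*v) D)" and "c \<noteq> 0"
    and "\<And>y. T v (A *v (D *v y)) (A *v (D *v y)) = c * ((y $ 1)^2 + (y $ 2)^2 + (y $ 3)^2)"
proof -
  interpret symmetric_trilinear T by fact
  obtain U V and \<phi> :: "complex^4 \<Rightarrow> complex^4" and \<psi> u where 0: "0 \<in> U" "\<phi> 0 = 0"
    and hom: "homeomorphism U V \<phi> \<psi>" and hol: "holo_map_on \<phi> U" "holo_map_on \<psi> V" "holo_fun_on u U"
    and u: "\<And>y. y \<in> U \<Longrightarrow> u y \<noteq> 0"
    and eq: "\<And>y. y \<in> U \<Longrightarrow>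
      F (v + A *v \<phi> y) = u y * ((y $ 1)^2 + (y $ 2)^2 + (y $ 3)^2 + (y $ 4)^(n + 1))"
    using germ unfolding A_germ_def by blast
  have U: "open U" using hol by (simp add: holo_fun_on_def)
  have "0 \<in> V" using hom 0 by (force simp: homeomorphism_def)
  obtain D where D: "(\<phi> has_derivative (*v) D) (at 0)"
    using holo_map_on_has_derivative hol(1) 0(1) by blast
  obtain E where E: "(\<psi> has_derivative (*v) E) (at 0)"
    using holo_map_on_has_derivative hol(2) \<open>0 \<in> V\<close> by blast
  \<comment> \<open>The chain rule for \<open>\<psi>\<close> after \<open>\<phi>\<close>, which is
    the identity on \<open>U\<close>, makes \<open>E\<close> a left inverse of
    \<open>D\<close>.\<close>
  have "((\<lambda>x. \<psi> (\<phi> x)) has_derivative (\<lambda>h. E *v (D *v h))) (at 0)"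
    using has_derivative_compose[OF D] E 0 by simp
  then have "((\<lambda>x. x) has_derivative (\<lambda>h. E *v (D *v h))) (at 0)"
    by (rule has_derivative_transform_within_open[OF _ U 0(1)]) (use hom in \<open>auto simp: homeomorphism_def\<close>)
  then have "(\<lambda>h. E *v (D *v h)) = (\<lambda>h. h)"
    using has_derivative_unique has_derivative_ident by blast
  then have inj: "inj ((*v) D)"
    by (intro inj_on_inverseI[where g = "(*v) E"]) meson
  have cont_u: "isCont u 0"
    using hol(3) 0(1) has_derivative_continuous by (fastforce simp: holo_fun_on_def)
  txt \<open>Compare the coefficients of \<open>t\<^sup>2\<close> in the germ equation along \<open>y \<mapsto> t y\<close>.\<close>
  have "3 * T v (A *v (D *v y)) (A *v (D *v y)) = u 0 * ((y $ 1)^2 + (y $ 2)^2 + (y $ 3)^2)" for y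
  proof -
    \<comment> \<open>The difference quotient of \<open>\<phi>\<close> along \<open>y\<close>, moved
      by \<open>A\<close>. For \<open>t \<noteq> 0\<close> the curve in the germ equation is
      \<open>v + t *s z t\<close>, to which \<open>cube_line\<close> applies; the limits ignore the
      value at \<open>t = 0\<close>.\<close>
    define z where "z t = A *v (inverse t *s \<phi> (t *s y))" for t
    have scale: "((\<lambda>t. t *s y) has_derivative (\<lambda>t. t *s y)) (at 0)"
      by (rule has_derivative_vector_scalar)
    have t0: "((\<lambda>t. t *s y) \<longlongrightarrow> 0) (at 0)"
      using has_derivative_continuous[OF scale] by (simp add: isCont_def)
    have "((\<lambda>t. inverse t *s \<phi> (t *s y)) \<longlongrightarrow> D *v y) (at 0)"
    proof (rule vec_tendstoI)
      fix i
      have "((\<lambda>t. \<phi> (t *s y)) has_derivative (\<lambda>t. D *v (t *s y))) (at 0)"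
        using has_derivative_compose[OF scale] D by simp
      then have "((\<lambda>t. \<phi> (t *s y) $ i) has_derivative (\<lambda>t. (D *v (t *s y)) $ i)) (at 0)"
        by (rule bounded_linear.has_derivative[OF bounded_linear_vec_nth])
      then have "((\<lambda>t. \<phi> (t *s y) $ i) has_field_derivative (D *v y) $ i) (at 0)"
        by (rule has_derivative_imp_has_field_derivative) (simp add: vec.scale)
      then show "((\<lambda>t. (inverse t *s \<phi> (t *s y)) $ i) \<longlongrightarrow> (D *v y) $ i) (at 0)"
        using 0 by (simp add: DERIV_def divide_inverse mult.commute)
    qed
    then have z: "(z \<longlongrightarrow> A *v (D *v y)) (at 0)"
      unfolding z_def 
      by (rule tendsto_compose[rotated]) 
        (use matrix_vector_mul_linear in \<open>simp add: isCont_def[symmetric] linear_continuous_at linear_conv_bounded_linear\<close>)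
    have F_lim: "((\<lambda>t. F (f t)) \<longlongrightarrow> F l) G" if "(f \<longlongrightarrow> l) G" for f l and G :: "complex filter"
      using contF that by (simp add: continuous_on_tendsto_compose)
    \<comment> \<open>The second difference of \<open>F\<close> recovers the Hessian form, so
      continuity of \<open>F\<close> alone yields the limit of
      \<open>T v (z t) (z t)\<close>.\<close>
    have T_v: "T v w w = (F (v + w) + F (v - w) - 2 * F v) / 6" for w
      using cube_line[of v 1 w] cube_line[of v "-1" w] by (simp add: F)
    have lim1: "((\<lambda>t. 3 * T v (z t) (z t) + t * F (z t)) \<longlongrightarrow>
        3 * T v (A *v (D *v y)) (A *v (D *v y)) + 0 * F (A *v (D *v y))) (at 0)"
      unfolding T_v by (intro tendsto_intros F_lim z) simp
    \<comment> \<open>The exponent \<open>n - 1\<close> is what remains of \<open>n + 1\<close>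
      after division by \<open>t^2\<close>; it is positive, so the last term tends to zero.\<close>
    have lim2: "((\<lambda>t. u (t *s y) * ((y $ 1)^2 + (y $ 2)^2 + (y $ 3)^2 + t ^ (n - 1) * (y $ 4)^(n + 1))) \<longlongrightarrow>
        u 0 * ((y $ 1)^2 + (y $ 2)^2 + (y $ 3)^2 + 0 ^ (n - 1) * (y $ 4)^(n + 1))) (at 0)"
      by (intro tendsto_intros isCont_tendsto_compose[OF cont_u] t0)
    have "\<forall>\<^sub>F t in at 0. t *s y \<in> U"
      using topological_tendstoD[OF t0 U] 0 by simp
    moreover have "\<forall>\<^sub>F t in at (0::complex). t \<noteq> 0"
      by (simp add: eventually_at_filter)
    ultimately have "\<forall>\<^sub>F t in at 0. 3 * T v (z t) (z t) + t * F (z t) =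
        u (t *s y) * ((y $ 1)^2 + (y $ 2)^2 + (y $ 3)^2 + t ^ (n - 1) * (y $ 4)^(n + 1))"
    proof eventually_elim
      case (elim t)
      have "A *v \<phi> (t *s y) = t *s z t"
        using elim by (simp add: z_def vec.scale)
      then have "t^2 * (3 * T v (z t) (z t) + t * F (z t)) = F (v + A *v \<phi> (t *s y))"
        using cube_line[of v t "z t"] v by (simp add: F algebra_simps power2_eq_square power3_eq_cube)
      also have "\<dots> = t^2 * (u (t *s y) * ((y $ 1)^2 + (y $ 2)^2 + (y $ 3)^2 + t ^ (n - 1) * (y $ 4)^(n + 1)))"
      proof -
        have "t ^ (n + 1) = t^2 * t ^ (n - 1)"
          using n by (simp flip: power_add)
        then show ?thesis
          unfolding eq[OF elim(1)] by (simp add: power_mult_distrib algebra_simps)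
      qed
      finally show ?case using elim by simp
    qed
    then have "((\<lambda>t. 3 * T v (z t) (z t) + t * F (z t)) \<longlongrightarrow>
        u 0 * ((y $ 1)^2 + (y $ 2)^2 + (y $ 3)^2 + 0 ^ (n - 1) * (y $ 4)^(n + 1))) (at 0)"
      using Lim_transform_eventually[OF lim2] by (simp add: eq_commute)
    from tendsto_unique[OF _ lim1 this]
    show ?thesis using n by (simp add: power_0_left trivial_limit_at)
  qed
  then have "T v (A *v (D *v y)) (A *v (D *v y)) = u 0 / 3 * ((y $ 1)^2 + (y $ 2)^2 + (y $ 3)^2)" for y
    by (simp add: field_simps)
  then show ?thesis
    using that[OF inj, of "u 0 / 3"] u 0 by simp
qed


section \<open>The direction common to all planes through a singular point\<close>

lemma exists_outside_span:
  fixes S :: "(complex^'n) set"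
  assumes "card B < vec.dim S" and "finite B"
  obtains a where "a \<in> S" "a \<notin> vec.span B"
  using assms vec.dim_le_card[of S B] by (meson leD subsetI)

lemma proj_point_eq_span:
  assumes "proj_point p" "x \<in> p" "x \<noteq> 0"
  shows "p = vec.span {x}"
  using assms by (intro vec.subspace_dim_equal[symmetric]) (simp_all add: proj_subspace_def vec.span_minimal)

text \<open>Modulo \<open>v\<close>, a plane of the cubic through \<open>[v]\<close> is a
  two-dimensional isotropic space for a rank 3 form in four variables. Its projection to the three
  nondegenerate variables has dimension at most one, so it contains the kernel direction
  \<open>k\<close>.\<close>

lemma A_point_planes_direction:
  assumes T: "symmetric_trilinear T" and F: "F = (\<lambda>x. T x x x)" and contF: "continuous_on UNIV F"
    and A: "singularity_type_A n F p" and n: "n \<ge> 2"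
  obtains v k where "v \<in> p" "v \<noteq> 0" "k \<notin> vec.span {v}"
    and "\<forall>S. proj_plane S \<and> v \<in> S \<and> (\<forall>x\<in>S. F x = 0) \<longrightarrow> k \<in> S"
proof -
  interpret symmetric_trilinear T by fact
  obtain v and A :: "complex^4^5" where p: "p \<in> singular_points F" "v \<in> p"
    and A: "inj ((*v) A)" "v \<notin> range ((*v) A)" and germ: "A_germ n (\<lambda>y. F (v + A *v y))"
    using A unfolding singularity_type_A_def by blast
  have v0: "v \<noteq> 0"
    using A(2) by (metis matrix_vector_mult_0_right rangeI)
  have Tv: "T v v w = 0" for w
    using singular_imp_polar_zero[OF T F p] .
  then have Fv: "F v = 0"
    by (simp add: F)
  obtain D :: "complex^4^4" and c where D: "inj ((*v) D)" and c: "c \<noteq> 0"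
    and q: "\<And>y. T v (A *v (D *v y)) (A *v (D *v y)) = c * ((y $ 1)^2 + (y $ 2)^2 + (y $ 3)^2)"
    using A_germ_quadratic_part[OF T F contF Fv Tv germ n] by blast
  define M where "M = A ** D"
  have M: "M *v y = A *v (D *v y)" for y
    by (simp add: M_def matrix_vector_mul_assoc)
  have injM: "inj ((*v) M)"
    using A(1) D by (auto simp: inj_def M)
  have vM: "v \<notin> range ((*v) M)"
    using A(2) by (auto simp: M)
  have polar: "T v (M *v y) (M *v y') = c * (y $ 1 * y' $ 1 + y $ 2 * y' $ 2 + y $ 3 * y' $ 3)" for y y'
  proof -
    have "T v (M *v (y + y')) (M *v (y + y')) =
        T v (M *v y) (M *v y) + T v (M *v y') (M *v y') + 2 * T v (M *v y) (M *v y')"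
      using swap_right[of v "M *v y'" "M *v y"] by (simp add: vec.add expand)
    then have "2 * T v (M *v y) (M *v y') =
        2 * (c * (y $ 1 * y' $ 1 + y $ 2 * y' $ 2 + y $ 3 * y' $ 3))"
      unfolding q[folded M] by (simp add: algebra_simps power2_eq_square)
    then show ?thesis by simp
  qed
  \<comment> \<open>The range of \<open>M\<close> has dimension 4 and misses \<open>v\<close>, so
    together they span the whole space.\<close>
  have decomp: "\<exists>a y. x = a *s v + M *v y" for x
  proof -
    have sub: "vec.subspace (range ((*v) M))"
      by (rule vec.subspace_image[OF vec.subspace_UNIV])
    have "vec.dim (range ((*v) M)) = 4"
      using vec.dim_image_eq[of "(*v) M" UNIV] injM by (simp add: vec_dim_card del: vec.dim_UNIV)
    then have "vec.dim (insert v (range ((*v) M))) = 5"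
      using vM by (simp add: vec.dim_insert vec.span_eq_iff[THEN iffD2, OF sub])
    then have "vec.span (insert v (range ((*v) M))) = UNIV"
      using vec.dim_eq_span[OF subset_UNIV, of "insert v (range ((*v) M))"]
      by (simp add: vec_dim_card del: vec.dim_UNIV)
    then have "x \<in> vec.span (insert v (range ((*v) M)))" by simp
    then obtain a where "x - a *s v \<in> range ((*v) M)"
      unfolding vec.span_breakdown_eq vec.span_eq_iff[THEN iffD2, OF sub] by blast
    then show ?thesis
      by (metis add.commute diff_add_cancel imageE)
  qed
  \<comment> \<open>The fourth coordinate does not occur in \<open>polar\<close>, so
    \<open>k\<close> lies in the kernel of the Hessian form.\<close>
  define k where "k = M *v axis 4 1"
  have k: "k \<notin> vec.span {v}"
  proof
    assume "k \<in> vec.span {v}"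
    then obtain a where a: "M *v axis 4 1 = a *s v"
      by (auto simp: k_def vec.span_singleton)
    show False
    proof (cases "a = 0")
      case True
      then have "M *v axis 4 1 = M *v 0" using a by simp
      then have "axis 4 1 = (0 :: complex^4)" using injM by (meson injD)
      then show False by simp
    next
      case False
      then have "v = M *v (inverse a *s axis 4 1)" using a by (simp add: vec.scale)
      then show False using vM by blast
    qed
  qed
  have "k \<in> S" if S: "proj_plane S" "v \<in> S" and F0: "\<And>x. x \<in> S \<Longrightarrow> F x = 0" for S
  proof -
    have sub: "vec.subspace S" and dim: "vec.dim S = 3"
      using S by (auto simp: proj_subspace_def)
    have T0: "T x y z = 0" if "x \<in> S" "y \<in> S" "z \<in> S" for x y z
      using vanish_on_subspace[OF sub _ that] F0 by (simp add: F)
    \<comment> \<open>\<open>a\<close> and \<open>b\<close> are chosen to complete \<open>v\<close>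
      to a basis of \<open>S\<close>.\<close>
    obtain a where a: "a \<in> S" "a \<notin> vec.span {v}"
      using exists_outside_span[of "{v}" S] dim by auto
    have "card {a, v} < vec.dim S" using dim by (simp add: card_insert_if)
    then obtain b where b: "b \<in> S" "b \<notin> vec.span {a, v}"
      using exists_outside_span[of "{a, v}" S] by auto
    obtain a0 y where y: "a = a0 *s v + M *v y" using decomp by blast
    obtain b0 y' where y': "b = b0 *s v + M *v y'" using decomp by blast
    have pv: "T v w v = 0" for w using Tv swap_right by metis
    have "T v a a = c * (y $ 1 * y $ 1 + y $ 2 * y $ 2 + y $ 3 * y $ 3)"
      "T v b b = c * (y' $ 1 * y' $ 1 + y' $ 2 * y' $ 2 + y' $ 3 * y' $ 3)"
      "T v a b = c * (y $ 1 * y' $ 1 + y $ 2 * y' $ 2 + y $ 3 * y' $ 3)"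
      by (simp_all add: y y' expand Tv pv polar)
    then have iso: "(y $ 1)^2 + (y $ 2)^2 + (y $ 3)^2 = 0" "(y' $ 1)^2 + (y' $ 2)^2 + (y' $ 3)^2 = 0"
      "y $ 1 * y' $ 1 + y $ 2 * y' $ 2 + y $ 3 * y' $ 3 = 0"
      using T0 S a b c by (simp_all add: power2_eq_square)
    \<comment> \<open>The truncations of \<open>y\<close> and \<open>y'\<close> to three coordinates
      are dependent; the same combination of \<open>y\<close> and \<open>y'\<close> keeps only its
      fourth coordinate, hence maps to a multiple of \<open>k\<close>.\<close>
    obtain \<alpha> \<beta> where nz: "\<alpha> \<noteq> 0 \<or> \<beta> \<noteq> 0"
      and "\<alpha> *s vector [y $ 1, y $ 2, y $ 3] + \<beta> *s vector [y' $ 1, y' $ 2, y' $ 3] = (0 :: complex^3)"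
      using isotropic_pair_dependent[of "vector [y $ 1, y $ 2, y $ 3]" "vector [y' $ 1, y' $ 2, y' $ 3]"] iso
      by (auto simp: vector_3)
    then have "\<alpha> *s y + \<beta> *s y' = (\<alpha> * y $ 4 + \<beta> * y' $ 4) *s axis 4 1" (is "_ = ?r *s _")
      by (simp add: vec_eq_iff forall_3 forall_4 vector_3 axis_def)
    then have "M *v (\<alpha> *s y + \<beta> *s y') = ?r *s k"
      by (simp only: k_def vec.scale)
    moreover have "\<alpha> *s a + \<beta> *s b = (\<alpha> * a0 + \<beta> * b0) *s v + M *v (\<alpha> *s y + \<beta> *s y')"
      unfolding y y' vec.add vec.scale by (simp add: vec_eq_iff algebra_simps)
    ultimately have comb: "\<alpha> *s a + \<beta> *s b = (\<alpha> * a0 + \<beta> * b0) *s v + ?r *s k"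
      by (simp only:)
    define r where "r = ?r"
    define d where "d = \<alpha> * a0 + \<beta> * b0"
    note comb = comb[folded r_def d_def]
    \<comment> \<open>Otherwise \<open>comb\<close> would be a nontrivial linear relation among
      \<open>a\<close>, \<open>b\<close> and \<open>v\<close>.\<close>
    have "r \<noteq> 0"
    proof
      assume "r = 0"
      then have e: "\<alpha> *s a + \<beta> *s b = d *s v" using comb by simp
      have "\<beta> = 0"
      proof (rule ccontr)
        assume "\<beta> \<noteq> 0"
        then have "b = inverse \<beta> *s (d *s v - \<alpha> *s a)" using e by (simp add: vec_eq_iff field_simps)
        moreover have "inverse \<beta> *s (d *s v - \<alpha> *s a) \<in> vec.span {a, v}"
          by (intro vec.span_scale vec.span_diff vec.span_base) auto
        ultimately show False using b by simp
      qed
      then have "a = (d / \<alpha>) *s v" using e nz by (simp add: vec_eq_iff field_simps)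
      then show False using a by (auto simp: vec.span_singleton)
    qed
    then have "k = inverse r *s (\<alpha> *s a + \<beta> *s b - d *s v)"
      by (simp add: comb)
    also have "\<dots> \<in> S"
      using sub S a b by (intro vec.subspace_scale vec.subspace_diff vec.subspace_add)
    finally show ?thesis .
  qed
  with p v0 k show ?thesis using that by blast
qed

section \<open>The plane joining the two outer singular points\<close>

text \<open>On the span of \<open>z\<close>, \<open>x\<close>, \<open>m\<close> every monomial of
  the cubic vanishes: those with a repeated \<open>x\<close> or \<open>z\<close> by singularity,
  those with a repeated \<open>m\<close> because \<open>m\<close> lies in both planes, and the mixed
  one by the choice of \<open>m\<close>.\<close>

lemma (in symmetric_trilinear) plane_through_singular_pair:
  assumes S: "vec.subspace S1" "vec.subspace S2"
    and van: "\<And>x. x \<in> S1 \<Longrightarrow> T x x x = 0" "\<And>x. x \<in> S2 \<Longrightarrow> T x x x = 0"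
    and v: "v \<in> S1 \<inter> S2" "v \<noteq> 0" and k: "k \<in> S1 \<inter> S2" "k \<notin> vec.span {v}"
    and x: "x \<in> S1 - S2" "\<And>w. T x x w = 0" and z: "z \<in> S2 - S1" "\<And>w. T z z w = 0"
  obtains P where "vec.subspace P" "vec.dim P = 3" "x \<in> P" "z \<in> P" "\<And>w. w \<in> P \<Longrightarrow> T w w w = 0"
proof -
  obtain m where m: "m \<in> S1 \<inter> S2" "m \<noteq> 0" "T x z m = 0"
  proof (cases "T x z v = 0")
    case True
    then show ?thesis using that v by blast
  next
    case False
    \<comment> \<open>The solution of the linear equation \<open>T x z m = 0\<close> on the span of
      \<open>v\<close> and \<open>k\<close>, nonzero because \<open>k\<close> is not a multiple of
      \<open>v\<close>.\<close>
    let ?m = "T x z v *s k - T x z k *s v"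
    have "?m \<noteq> 0"
    proof
      assume "?m = 0"
      then have "k = (T x z k / T x z v) *s v" using False by (simp add: vec_eq_iff field_simps)
      then show False using k by (auto simp: vec.span_singleton)
    qed
    moreover have "?m \<in> S1 \<inter> S2"
      using S v k by (simp add: vec.subspace_diff vec.subspace_scale)
    moreover have "T x z ?m + T x z (T x z k *s v) = T x z (T x z v *s k)"
      by (simp flip: add_right)
    then have "T x z ?m = 0" by (simp add: scale_right)
    ultimately show ?thesis using that by blast
  qed
  have "vec.span {m} \<subseteq> S2" "vec.span {x, m} \<subseteq> S1"
    using m x S by (simp_all add: vec.span_minimal)
  then have "x \<notin> vec.span {m}" "z \<notin> vec.span {x, m}"
    using x z by auto
  then have dim: "vec.dim (vec.span {z, x, m}) = 3"
    using m by (simp add: vec.dim_insert)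
  have "T w w w = 0" if "w \<in> vec.span {z, x, m}" for w
  proof -
    obtain a b d where "w - a *s z - b *s x = d *s m"
      using \<open>w \<in> _\<close> by (auto simp: vec.span_breakdown_eq)
    then have w: "w = a *s z + b *s x + d *s m"
      by (simp add: algebra_simps)
    have mm: "T m m x = 0" "T m m z = 0" "T m m m = 0"
      using vanish_on_subspace[OF S(1) van(1)] vanish_on_subspace[OF S(2) van(2)] m x z by auto
    \<comment> \<open>Sorting the arguments reduces every term of the expansion to one of the known
      zeros.\<close>
    have perm: "T m x m = T m m x" "T x m m = T m m x" "T m z m = T m m z" "T z m m = T m m z"
      "T x m x = T x x m" "T m x x = T x x m" "T z m z = T z z m" "T m z z = T z z m"
      "T x z x = T x x z" "T z x x = T x x z" "T z x z = T z z x" "T x z z = T z z x"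
      "T x m z = T x z m" "T m x z = T x z m" "T m z x = T x z m" "T z x m = T x z m" "T z m x = T x z m"
      by (metis swap_left swap_right)+
    show ?thesis
      by (simp add: w expand perm mm m x z)
  qed
  then show ?thesis
    using that[of "vec.span {z, x, m}"] dim by (simp add: vec.span_base)
qed

theorem proposition9p13:
  fixes F :: "complex^5 \<Rightarrow> complex"
  assumes "stable_cubic_threefold F"
    and "\<And>p. p \<in> singular_points F \<Longrightarrow> singularity_type_A 3 F p"
  shows "\<forall>p\<in>singular_points F. \<forall>q\<in>singular_points F. \<forall>s\<in>singular_points F.
           p \<noteq> q \<and> q \<noteq> s \<and> p \<noteq> s \<longrightarrow>
           coplanar_points F p q \<longrightarrow> coplanar_points F q s \<longrightarrow> coplanar_points F p s"
proof (intro ballI impI)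
  fix p q s
  assume p: "p \<in> singular_points F" and q: "q \<in> singular_points F" and s: "s \<in> singular_points F"
    and ne: "p \<noteq> q \<and> q \<noteq> s \<and> p \<noteq> s" and pq: "coplanar_points F p q" and qs: "coplanar_points F q s"
  have cubic: "cubic_form F"
    using assms by (simp add: stable_cubic_threefold_def)
  then obtain T where T: "symmetric_trilinear T" and F: "F = (\<lambda>x. T x x x)"
    by (rule cubic_form_polarization)
  interpret symmetric_trilinear T by fact
  have F0: "F 0 = 0" using scale_left[of 0 0 0 0] by (simp add: F)
  obtain S1 where S1: "proj_plane S1" "p \<subseteq> S1" "q \<subseteq> S1" "{r. proj_point r \<and> r \<subseteq> S1} \<subseteq> hypersurface F"
    using pq by (auto simp: coplanar_points_def)
  obtain S2 where S2: "proj_plane S2" "q \<subseteq> S2" "s \<subseteq> S2" "{r. proj_point r \<and> r \<subseteq> S2} \<subseteq> hypersurface F"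
    using qs by (auto simp: coplanar_points_def)
  have sub: "vec.subspace S1" "vec.subspace S2"
    using S1 S2 by (auto simp: proj_subspace_def)
  have van: "\<And>x. x \<in> S1 \<Longrightarrow> F x = 0" "\<And>x. x \<in> S2 \<Longrightarrow> F x = 0"
    using zero_on_plane[OF S1(4) sub(1) _ F0] zero_on_plane[OF S2(4) sub(2) _ F0] by auto
  have le: "2 \<le> (3::nat)" by simp
  obtain v k where v: "v \<in> q" "v \<noteq> 0" and k: "k \<notin> vec.span {v}"
    and planes: "\<forall>S. proj_plane S \<and> v \<in> S \<and> (\<forall>x\<in>S. F x = 0) \<longrightarrow> k \<in> S"
    by (rule A_point_planes_direction[OF T F cubic_form_continuous[OF cubic] assms(2)[OF q] le])
  have points: "\<exists>x\<in>r. x \<noteq> 0 \<and> r = vec.span {x}" if "r \<in> singular_points F" for r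
  proof -
    have r: "proj_point r" using that by (simp add: singular_points_def hypersurface_def)
    then obtain x where "x \<in> r" "x \<notin> vec.span {}"
      using exists_outside_span[of "{}" r] by (auto simp: proj_subspace_def)
    then show ?thesis using proj_point_eq_span[OF r] by auto
  qed
  obtain x where x: "x \<in> p" "p = vec.span {x}" using points[OF p] by blast
  obtain z where z: "z \<in> s" "s = vec.span {z}" using points[OF s] by blast
  show "coplanar_points F p s"
  \<comment> \<open>If one given plane already contains all three points, it witnesses the
    coplanarity of \<open>p\<close> and \<open>s\<close>.\<close>
  proof (cases "x \<in> S2 \<or> z \<in> S1")
    case True
    then have "p \<subseteq> S2 \<or> s \<subseteq> S1"
      using x z sub vec.span_minimal[of "{x}" S2] vec.span_minimal[of "{z}" S1] by auto
    then show ?thesis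
      using p s ne S1 S2 unfolding coplanar_points_def by blast
  next
    case False
    have vS: "v \<in> S1 \<inter> S2"
      using S1(3) S2(2) v(1) by blast
    \<comment> \<open>Both planes pass through \<open>q\<close> and lie in the cubic, so both
      contain the common direction.\<close>
    moreover have "k \<in> S1 \<inter> S2"
      using planes S1(1) S2(1) vS van by simp
    moreover have "x \<in> S1 - S2" "z \<in> S2 - S1"
      using False S1 S2 x z by auto
    moreover have "\<And>w. T x x w = 0" "\<And>w. T z z w = 0"
      using singular_imp_polar_zero[OF T F] p s x z by auto
    ultimately obtain P where P: "vec.subspace P" "vec.dim P = 3" "x \<in> P" "z \<in> P"
        and FP: "\<And>w. w \<in> P \<Longrightarrow> T w w w = 0"
      using plane_through_singular_pair[OF sub van[unfolded F] _ v(2) _ k] by blast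
    have "proj_plane P" using P by (simp add: proj_subspace_def)
    moreover have "p \<subseteq> P" "s \<subseteq> P"
      using P x z by (simp_all add: vec.span_minimal)
    moreover have "{r. proj_point r \<and> r \<subseteq> P} \<subseteq> hypersurface F"
      using FP by (auto simp: hypersurface_def F)
    ultimately show ?thesis
      using p s ne unfolding coplanar_points_def by blast
  qed
qed

end
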